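(* Let $\mathbb{X},\mathbb{Y}$ be nonzero real Banach spaces such that at least one of the following conditions holds: (i) $SE(\mathbb{X})$ is (norm) dense in $\mathbb{X}^*$; (ii) the set of all points of Fréchet differentiability of the norm of $\mathbb{Y}$ is dense in $\mathbb{Y}$. Let $\mathcal{W}$ be a linear subspace of $\mathbb{L}(\mathbb{X},\mathbb{Y})$ containing $\mathbb{F}(\mathbb{X},\mathbb{Y})$. Then $\mathcal{W}$ has the BCP if and only if both $\mathbb{X}^*$ and $\mathbb{Y}$ have the BCP.
   Context: $\mathbb{L}(\mathbb{X},\mathbb{Y})$ is the space of bounded linear operators from $\mathbb{X}$ to $\mathbb{Y}$ with the operator norm, and $\mathbb{F}(\mathbb{X},\mathbb{Y})$ is its subspace of finite-rank operators; $\mathcal{W}$ carries the operator norm. A normed space $\mathbb{Z}$ has the Ball Covering Property (BCP) if there are $z_n\in\mathbb{Z}\setminus\{0\}$ and $0<r_n\le\|z_n\|$ ($n\in\mathbb{N}$) such that $S_{\mathbb{Z}}\subseteq\bigcup_n B(z_n,r_n)$, where $S_{\mathbb{Z}}$ is the unit sphere and $B(z,r)$ is the open ball of center $z$ and radius $r$. For $x\in S_{\mathbb{X}}$ and $x^*\in S_{\mathbb{X}^*}$ with $x^*(x)=1$, $x^*$ strongly exposes $x$ in $B_{\mathbb{X}}$ (the closed unit ball) if for every sequence $\{x_n\}\subset B_{\mathbb{X}}$, $x^*(x_n)\to1$ implies $x_n\to x$ in norm. $SE(B_{\mathbb{X}})$ is the set of all $x^*\in S_{\mathbb{X}^*}$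 that strongly expose some point of $B_{\mathbb{X}}$, and $SE(\mathbb{X}):=\{\lambda x^*:\lambda\in\mathbb{R}\setminus\{0\},\,x^*\in SE(B_{\mathbb{X}})\}$. The norm of $\mathbb{Y}$ is Fréchet differentiable at a nonzero $y$ if $\lim_{t\to0}\frac{\|y+tz\|-\|y\|}{t}$ exists for every $z\in\mathbb{Y}$, uniformly for $z\in S_{\mathbb{Y}}$. *)

theory Defs
  imports "HOL-Analysis.Analysis"
begin

text \<open>The normed space is a linear subspace \<open>Z\<close> of the ambient type, with the inherited norm
  (\<open>Z = UNIV\<close> for the whole space). The centres must lie in \<open>Z\<close>; cutting the ambient balls down
  to \<open>Z\<close> would make no difference, since only points of \<open>Z\<close> have to be covered.\<close>

definition BCP :: "'a::real_normed_vector set \<Rightarrow> bool" where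
  "BCP Z \<longleftrightarrow>
    (\<exists>(z :: nat \<Rightarrow> 'a) (r :: nat \<Rightarrow> real).
       (\<forall>n. z n \<in> Z - {0} \<and> 0 < r n \<and> r n \<le> norm (z n)) \<and>
       {x \<in> Z. norm x = 1} \<subseteq> (\<Union>n. ball (z n) (r n)))"

definition finite_rank_ops :: "('a::real_normed_vector \<Rightarrow>\<^sub>L 'b::real_normed_vector) set" where
  "finite_rank_ops = {T. \<exists>B. finite B \<and> range (blinfun_apply T) \<subseteq> span B}"

definition strongly_exposes :: "('a::real_normed_vector \<Rightarrow>\<^sub>L real) \<Rightarrow> 'a \<Rightarrow> bool" where
  "strongly_exposes f x \<longleftrightarrow>
    norm f = 1 \<and> norm x = 1 \<and> blinfun_apply f x = 1 \<and>
    (\<forall>s :: nat \<Rightarrow> 'a. (\<forall>n. s n \<in> cball 0 1) \<longrightarrow>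
       (\<lambda>n. blinfun_apply f (s n)) \<longlonglongrightarrow> 1 \<longrightarrow> s \<longlonglongrightarrow> x)"

definition SE_ball :: "('a::real_normed_vector \<Rightarrow>\<^sub>L real) set" where
  "SE_ball = {f. norm f = 1 \<and> (\<exists>x \<in> cball 0 1. strongly_exposes f x)}"

definition SE :: "('a::real_normed_vector \<Rightarrow>\<^sub>L real) set" where
  "SE = {c *\<^sub>R f | c f. c \<noteq> 0 \<and> f \<in> SE_ball}"

definition norm_frechet_differentiable_at :: "'a::real_normed_vector \<Rightarrow> bool" where
  "norm_frechet_differentiable_at y \<longleftrightarrow>
    y \<noteq> 0 \<and>
    (\<exists>D :: 'a \<Rightarrow> real.
       (\<forall>z. ((\<lambda>t. (norm (y + t *\<^sub>R z) - norm y) / t) \<longlongrightarrow> D z) (at 0)) \<and>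
       uniform_limit (sphere 0 1) (\<lambda>t z. (norm (y + t *\<^sub>R z) - norm y) / t) D (at 0))"

end

theory Submission
  imports Defs
begin

text \<open>A nonzero space has the ball covering property exactly when it contains countably many centres \<open>z\<close>
  such that every nonzero \<open>x\<close> is \<^emph>\<open>seen\<close> by one of them, in the sense that
  \<open>norm (z - s *\<^sub>R x) < norm z\<close> for some \<open>s > 0\<close> (\<open>BCP_iff_sees_all\<close>). Radii and normalisation
  disappear; the condition is open in \<open>z\<close>, passes to smaller \<open>s\<close> by convexity of the norm, and
  survives linear contractions that almost preserve \<open>norm z\<close>.

  Suppose that the operators \<open>T\<^sub>n\<close> are centres for \<open>W\<close>. Evaluation at a point of the unit ball where
  \<open>T\<^sub>n\<close> almost attains its norm is a contraction of the last kind, and it maps the rank-one operators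
  \<open>rank_one f y\<close> with a fixed \<open>f\<close> to multiples of \<open>y\<close>; letting the quality of the approximation
  run through \<open>1 / real (Suc k)\<close> gives countably many centres for the range space. Composition with
  functionals that almost norm the adjoint of \<open>T\<^sub>n\<close> does the same for the dual
  (\<open>BCP_range_of_BCP_operators\<close>, \<open>BCP_dual_of_BCP_operators\<close>).

  Conversely, let the \<open>f\<close> in a countable set be centres for the dual and let the \<open>y\<close> in another be
  centres for the range space. The operators \<open>rank_one f y\<close> are centres for all operators, hence for
  \<open>W\<close>, provided that either every \<open>f\<close> is in \<open>SE\<close>, so that up to a positive factor it strongly exposes
  a point (\<open>SE_exposes\<close>), or every \<open>y\<close> is a point of Frechet
  differentiability; density of such functionals or points allows the centres to be chosen among
  them (\<open>sees_all_dense\<close>). In both cases the norm of \<open>rank_one f y - s *\<^sub>R T\<close> for small \<open>s\<close> is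
  governed by a single object:

  \<^item> If \<open>f\<close> strongly exposes \<open>x\<close> in this sense, only points near \<open>x\<close> contribute, so \<open>rank_one f y\<close> sees \<open>T\<close> as soon
  as \<open>y\<close> sees \<open>T x\<close> (\<open>rank_one_sees_exposing\<close>). Some \<open>f\<close> has \<open>T x \<noteq> 0\<close>: choose \<open>f\<close> to see a nonzero
  functional \<open>g o\<^sub>L T\<close>, which then cannot vanish at \<open>x\<close>.

  \<^item> If the norm is differentiable at \<open>y\<close> with derivative \<open>g\<close>, then it may be linearised there
  uniformly in the direction, so \<open>rank_one f y\<close> sees \<open>T\<close> as soon as \<open>f\<close> sees \<open>g o\<^sub>L T\<close>
  (\<open>rank_one_sees_frechet\<close>). Some \<open>y\<close> has \<open>g o\<^sub>L T \<noteq> 0\<close>: choose \<open>y\<close> to see a nonzero value of \<open>T\<close>.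

  The functionals come from the Hahn-Banach theorem, proved by the minimal sublinear functional
  argument.\<close>

section \<open>Supporting functionals\<close>

definition sublinear :: "('a::real_vector \<Rightarrow> real) \<Rightarrow> bool" where
  "sublinear p \<longleftrightarrow> (\<forall>x y. p (x + y) \<le> p x + p y) \<and> (\<forall>c x. c > 0 \<longrightarrow> p (c *\<^sub>R x) = c * p x)"

lemma sublinearI:
  assumes "\<And>x y. p (x + y) \<le> p x + p y" and hom: "\<And>c x. c > 0 \<Longrightarrow> p (c *\<^sub>R x) \<le> c * p x"
  shows "sublinear p"
proof -
  have "c * p x \<le> p (c *\<^sub>R x)" if "c > 0" for c x
  proof -
    have "p ((1/c) *\<^sub>R (c *\<^sub>R x)) \<le> (1/c) * p (c *\<^sub>R x)" using that by (intro hom) simp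
    then show ?thesis using that by (simp add: field_simps)
  qed
  then show ?thesis unfolding sublinear_def using assms by (meson order_antisym)
qed

lemma sublinear_add: "sublinear p \<Longrightarrow> p (x + y) \<le> p x + p y"
  and sublinear_scaleR: "sublinear p \<Longrightarrow> c > 0 \<Longrightarrow> p (c *\<^sub>R x) = c * p x"
  by (auto simp: sublinear_def)

lemma sublinear_zero:
  assumes "sublinear p" shows "p 0 = 0"
  using sublinear_scaleR[OF assms, of 2 0] by simp

lemma sublinear_minus_le:
  assumes "sublinear p" shows "- p (- x) \<le> p x"
  using sublinear_add[OF assms, of x "- x"] sublinear_zero[OF assms] by simp

lemma sublinear_norm: "sublinear (norm :: 'a::real_normed_vector \<Rightarrow> real)"
  by (rule sublinearI) (auto intro: norm_triangle_ineq)

text \<open>The largest sublinear functional below \<open>p\<close> whose value at \<open>- a\<close> is at most \<open>- p a\<close>;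
  a linear functional below it agrees with \<open>p\<close> at \<open>a\<close>.\<close>

definition lower_at :: "'a::real_vector \<Rightarrow> ('a \<Rightarrow> real) \<Rightarrow> 'a \<Rightarrow> real" where
  "lower_at a p x = (INF t\<in>{0..}. p (x + t *\<^sub>R a) - t * p a)"

lemma
  assumes "sublinear p"
  shows sublinear_lower_at: "sublinear (lower_at a p)"
    and lower_at_le: "lower_at a p x \<le> p x"
    and lower_at_minus: "lower_at a p (- a) \<le> - p a"
proof -
  have lb: "- p (- x) \<le> p (x + t *\<^sub>R a) - t * p a" if "t \<ge> 0" for x t
  proof -
    have "p (t *\<^sub>R a) = t * p a"
      using that sublinear_scaleR[OF assms, of t a] sublinear_zero[OF assms] by (cases "t = 0") auto
    moreover have "p (t *\<^sub>R a) \<le> p (x + t *\<^sub>R a) + p (- x)"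
      using sublinear_add[OF assms, of "x + t *\<^sub>R a" "- x"] by simp
    ultimately show ?thesis by simp
  qed
  have bdd: "bdd_below ((\<lambda>t. p (x + t *\<^sub>R a) - t * p a) ` {0..})" for x
    using lb by (intro bdd_belowI2) auto
  have low: "lower_at a p x \<le> p (x + t *\<^sub>R a) - t * p a" if "t \<ge> 0" for x t
    unfolding lower_at_def using bdd that by (intro cINF_lower) auto
  have great: "m \<le> lower_at a p x" if "\<And>t. t \<ge> 0 \<Longrightarrow> m \<le> p (x + t *\<^sub>R a) - t * p a" for m x
    unfolding lower_at_def using that by (intro cINF_greatest) auto
  show "lower_at a p x \<le> p x" for x using low[of 0 x] by simp
  show "lower_at a p (- a) \<le> - p a" using low[of 1 "- a"] sublinear_zero[OF assms] by simp
  show "sublinear (lower_at a p)"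
  proof (rule sublinearI)
    fix x y
    have "lower_at a p (x + y) - (p (y + u *\<^sub>R a) - u * p a) \<le> p (x + t *\<^sub>R a) - t * p a"
      if "t \<ge> 0" "u \<ge> 0" for t u
      using low[of "t + u" "x + y"] that sublinear_add[OF assms, of "x + t *\<^sub>R a" "y + u *\<^sub>R a"]
      by (simp add: algebra_simps)
    then have "lower_at a p (x + y) - (p (y + u *\<^sub>R a) - u * p a) \<le> lower_at a p x" if "u \<ge> 0" for u
      using that by (intro great) auto
    then have "lower_at a p (x + y) - lower_at a p x \<le> p (y + u *\<^sub>R a) - u * p a" if "u \<ge> 0" for u
      using that by (simp add: algebra_simps)
    then have "lower_at a p (x + y) - lower_at a p x \<le> lower_at a p y"
      by (intro great)
    then show "lower_at a p (x + y) \<le> lower_at a p x + lower_at a p y" by simp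
  next
    fix c :: real and x assume c: "c > 0"
    have "lower_at a p (c *\<^sub>R x) / c \<le> lower_at a p x"
    proof (rule great)
      fix t :: real assume t: "t \<ge> 0"
      have "lower_at a p (c *\<^sub>R x) \<le> p (c *\<^sub>R (x + t *\<^sub>R a)) - (c * t) * p a"
        using low[of "c * t" "c *\<^sub>R x"] c t by (simp add: scaleR_add_right)
      also have "\<dots> = c * (p (x + t *\<^sub>R a) - t * p a)"
        using sublinear_scaleR[OF assms c, of "x + t *\<^sub>R a"] by (simp add: right_diff_distrib)
      finally show "lower_at a p (c *\<^sub>R x) / c \<le> p (x + t *\<^sub>R a) - t * p a"
        using c by (simp add: field_simps)
    qed
    then show "lower_at a p (c *\<^sub>R x) \<le> c * lower_at a p x" using c by (simp add: field_simps)
  qed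
qed

text \<open>A minimal sublinear functional \<open>q\<close> equals each \<open>lower_at a q\<close>. This forces
  \<open>q (- a) = - q a\<close>, and an odd sublinear functional is linear.\<close>

lemma minimal_sublinear_linear:
  assumes q: "sublinear q" and min: "\<And>r. sublinear r \<Longrightarrow> r \<le> q \<Longrightarrow> r = q"
  shows "linear q"
proof -
  have odd: "q (- a) = - q a" for a
  proof -
    have "lower_at a q = q"
      using sublinear_lower_at[OF q] lower_at_le[OF q] by (intro min) (auto simp: le_fun_def)
    then have "q (- a) \<le> - q a" using lower_at_minus[OF q, of a] by simp
    then show ?thesis using sublinear_minus_le[OF q, of a] by simp
  qed
  show ?thesis
  proof (rule linearI)
    fix x y
    have "q (- x + - y) \<le> q (- x) + q (- y)" by (rule sublinear_add[OF q])
    moreover have "q (- x + - y) = - q (x + y)" using odd[of "x + y"] by simp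
    ultimately have "q x + q y \<le> q (x + y)" using odd by simp
    then show "q (x + y) = q x + q y" using sublinear_add[OF q, of x y] by simp
  next
    fix c :: real and x
    consider "c > 0" | "c = 0" | "- c > 0" by linarith
    then show "q (c *\<^sub>R x) = c *\<^sub>R q x"
    proof cases
      case 3
      then have "q ((- c) *\<^sub>R x) = - c * q x" by (rule sublinear_scaleR[OF q])
      then show ?thesis using odd[of "c *\<^sub>R x"] by simp
    qed (auto simp: sublinear_scaleR[OF q] sublinear_zero[OF q])
  qed
qed

text \<open>The pointwise infimum of a chain of sublinear functionals below \<open>p\<close> is again sublinear; it
  is finite since each member is at least \<open>- p (- x)\<close> at \<open>x\<close>. Zorn's lemma then gives a minimal
  one.\<close>

theorem ex_linear_below_sublinear:
  fixes p :: "'a::real_vector \<Rightarrow> real"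
  assumes p: "sublinear p"
  shows "\<exists>f. linear f \<and> f \<le> p"
proof -
  define A where "A = {q. sublinear q \<and> q \<le> p}"
  let ?P = "\<lambda>f g :: 'a \<Rightarrow> real. g \<le> f"
  have "\<exists>m\<in>A. \<forall>a\<in>A. ?P m a \<longrightarrow> a = m"
  proof (rule predicate_Zorn)
    show "partial_order_on A (relation_of ?P A)"
      by (rule partial_order_on_relation_ofI) auto
  next
    fix C assume C: "C \<in> Chains (relation_of ?P A)"
    then have CA: "C \<subseteq> A" and chain: "\<And>f g. f \<in> C \<Longrightarrow> g \<in> C \<Longrightarrow> f \<le> g \<or> g \<le> f"
      by (auto simp: Chains_def relation_of_def)
    show "\<exists>u\<in>A. \<forall>a\<in>C. u \<le> a"
    proof (cases "C = {}")
      case True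
      then show ?thesis using p by (auto simp: A_def)
    next
      case False
      define u where "u x = (INF f\<in>C. f x)" for x
      have lb: "- p (- x) \<le> f x" if "f \<in> C" for f x
      proof -
        have "sublinear f" "f \<le> p" using that CA by (auto simp: A_def)
        then show ?thesis using sublinear_minus_le[of f x] by (smt (verit) le_fun_def)
      qed
      have low: "u x \<le> f x" if "f \<in> C" for f x
        unfolding u_def using that lb[of _ x] by (intro cINF_lower bdd_belowI2) auto
      have great: "m \<le> u x" if "\<And>f. f \<in> C \<Longrightarrow> m \<le> f x" for m x
        unfolding u_def using that False by (intro cINF_greatest) auto
      have "sublinear u"
      proof (rule sublinearI)
        fix x y
        have "u (x + y) - g y \<le> f x" if fg: "f \<in> C" "g \<in> C" for f g
        proof -
          \<comment> \<open>the smaller of the two functionals handles both summands\<close>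
          obtain h where h: "h \<in> C" "h \<le> f" "h \<le> g" using chain[OF fg] fg by blast
          then have "u (x + y) \<le> h x + h y"
            using low[of h "x + y"] CA sublinear_add[of h x y] by (force simp: A_def)
          then show ?thesis using h by (smt (verit) le_fun_def)
        qed
        then have "u (x + y) - g y \<le> u x" if "g \<in> C" for g
          using that by (intro great) auto
        then have "u (x + y) - u x \<le> g y" if "g \<in> C" for g
          using that by (simp add: algebra_simps)
        then have "u (x + y) - u x \<le> u y" by (intro great)
        then show "u (x + y) \<le> u x + u y" by simp
      next
        fix c :: real and x assume c: "c > 0"
        have "u (c *\<^sub>R x) / c \<le> u x"
        proof (rule great)
          fix f assume f: "f \<in> C"
          then have "f (c *\<^sub>R x) = c * f x" using CA c sublinear_scaleR[of f c x] by (auto simp: A_def)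
          then show "u (c *\<^sub>R x) / c \<le> f x" using low[OF f, of "c *\<^sub>R x"] c by (simp add: field_simps)
        qed
        then show "u (c *\<^sub>R x) \<le> c * u x" using c by (simp add: field_simps)
      qed
      moreover have "u \<le> p"
      proof (rule le_funI)
        fix x
        obtain f where f: "f \<in> C" using False by blast
        then have "f \<le> p" using CA by (auto simp: A_def)
        then show "u x \<le> p x" using low[OF f, of x] by (auto simp: le_fun_def intro: order_trans)
      qed
      ultimately show ?thesis using low by (auto simp: A_def le_fun_def)
    qed
  qed
  then obtain m where m: "sublinear m" "m \<le> p"
    and min: "\<And>r. sublinear r \<Longrightarrow> r \<le> p \<Longrightarrow> r \<le> m \<Longrightarrow> r = m"
    unfolding A_def by auto
  have "linear m" using m(1) min m(2) by (intro minimal_sublinear_linear) (auto intro: order_trans)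
  then show ?thesis using m(2) by blast
qed

theorem ex_support_functional:
  fixes y :: "'a::real_normed_vector"
  shows "\<exists>g :: 'a \<Rightarrow>\<^sub>L real. norm g \<le> 1 \<and> blinfun_apply g y = norm y"
proof -
  obtain f where lin: "linear f" and le: "f \<le> lower_at y norm"
    using ex_linear_below_sublinear[OF sublinear_lower_at[OF sublinear_norm]] by blast
  have fx: "f x \<le> norm x" for x
    using le lower_at_le[OF sublinear_norm, of y x] by (auto simp: le_fun_def intro: order_trans)
  have f_minus: "f (- x) = - f x" for x by (rule linear_neg[OF lin])
  have abs: "\<bar>f x\<bar> \<le> norm x" for x using fx[of x] fx[of "- x"] f_minus[of x] by simp
  have "bounded_linear f"
    using abs lin by (intro bounded_linear.intro bounded_linear_axioms.intro exI[of _ 1]) auto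
  then have ap: "blinfun_apply (Blinfun f) = f" by (rule bounded_linear_Blinfun_apply)
  have "norm (Blinfun f) \<le> 1" using abs by (intro norm_blinfun_bound) (auto simp: ap)
  moreover have "f y = norm y"
  proof -
    have "f (- y) \<le> - norm y"
      using le lower_at_minus[OF sublinear_norm, of y] by (auto simp: le_fun_def intro: order_trans)
    then show ?thesis using fx[of y] f_minus[of y] by simp
  qed
  ultimately show ?thesis using ap by metis
qed

section \<open>Ball coverings as countable sets of centres\<close>

text \<open>A sphere point \<open>x\<close> lies in an open ball around a positive multiple of \<open>z\<close> that avoids the
  origin exactly when the norm drops on moving from \<open>z\<close> a little in the direction \<open>- x\<close>: if \<open>x\<close>
  is in such a ball around \<open>z\<close>, then also in the one around \<open>k z\<close> for \<open>k \<ge> 1\<close>.\<close>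

definition sees :: "'a::real_normed_vector \<Rightarrow> 'a \<Rightarrow> bool" where
  "sees z x \<longleftrightarrow> (\<exists>s>0. norm (z - s *\<^sub>R x) < norm z)"

definition sees_all :: "'a::real_normed_vector set \<Rightarrow> 'a set \<Rightarrow> bool" where
  "sees_all A Z \<longleftrightarrow> (\<forall>x\<in>Z - {0}. \<exists>z\<in>A. sees z x)"

lemma sees_nonzero: "sees z x \<Longrightarrow> z \<noteq> 0" "sees z x \<Longrightarrow> x \<noteq> 0"
  by (metis norm_not_less_zero norm_zero sees_def) (auto simp: sees_def)

text \<open>By convexity, the rate of descent over a long step persists for all shorter steps.\<close>

lemma sees_rate:
  assumes "sees z x"
  obtains s0 k where "s0 > 0" "k > 0" "\<And>s. 0 \<le> s \<Longrightarrow> s \<le> s0 \<Longrightarrow> norm (z - s *\<^sub>R x) \<le> norm z - s * k"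
proof -
  obtain s0 where s0: "s0 > 0" "norm (z - s0 *\<^sub>R x) < norm z" using assms by (auto simp: sees_def)
  define k where "k = (norm z - norm (z - s0 *\<^sub>R x)) / s0"
  have "norm (z - s *\<^sub>R x) \<le> norm z - s * k" if s: "0 \<le> s" "s \<le> s0" for s
  proof -
    define l where "l = s / s0"
    have l: "0 \<le> l" "l \<le> 1" "s = l * s0" using s s0 by (auto simp: l_def)
    have "z - s *\<^sub>R x = (1 - l) *\<^sub>R z + l *\<^sub>R (z - s0 *\<^sub>R x)" using l by (simp add: algebra_simps)
    then have "norm (z - s *\<^sub>R x) \<le> (1 - l) * norm z + l * norm (z - s0 *\<^sub>R x)"
      using l norm_triangle_ineq[of "(1 - l) *\<^sub>R z" "l *\<^sub>R (z - s0 *\<^sub>R x)"] by simp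
    also have "\<dots> = norm z - s * k" using s0 by (simp add: k_def l_def field_simps)
    finally show ?thesis .
  qed
  moreover have "k > 0" using s0 by (simp add: k_def)
  ultimately show ?thesis using that s0 by blast
qed

lemma sees_scaleR_left:
  assumes "sees z x" "c > 0"
  shows "sees (c *\<^sub>R z) x"
proof -
  obtain s where s: "s > 0" "norm (z - s *\<^sub>R x) < norm z" using assms by (auto simp: sees_def)
  have "norm (c *\<^sub>R z - (c * s) *\<^sub>R x) = c * norm (z - s *\<^sub>R x)"
    using assms(2) norm_scaleR[of c "z - s *\<^sub>R x"] by (simp add: algebra_simps)
  then show ?thesis using s assms(2) by (auto simp: sees_def intro!: exI[of _ "c * s"])
qed

lemma sees_scaleR_right:
  assumes "sees z (c *\<^sub>R x)"
  shows "sees z x \<or> sees (- z) x"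
proof -
  obtain s where s: "s > 0" "norm (z - s *\<^sub>R c *\<^sub>R x) < norm z" using assms by (auto simp: sees_def)
  have "c \<noteq> 0" using s by auto
  then consider "c > 0" | "c < 0" by linarith
  then show ?thesis
  proof cases
    case 1
    then show ?thesis using s by (auto simp: sees_def intro!: exI[of _ "s * c"])
  next
    case 2
    have "norm (- z - (s * - c) *\<^sub>R x) = norm (z - s *\<^sub>R c *\<^sub>R x)"
      using norm_minus_cancel[of "z - s *\<^sub>R c *\<^sub>R x"] by simp
    then have "sees (- z) x" unfolding sees_def
      using s 2 by (intro exI[of _ "s * - c"]) (auto simp: mult_pos_neg)
    then show ?thesis ..
  qed
qed

theorem BCP_iff_sees_all:
  fixes Z :: "'a::real_normed_vector set"
  assumes Z: "subspace Z" and nz: "Z \<noteq> {0}"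
  shows "BCP Z \<longleftrightarrow> (\<exists>A. countable A \<and> A \<subseteq> Z \<and> sees_all A Z)"
proof
  assume "BCP Z"
  then obtain z r where zr: "\<And>n. z n \<in> Z - {0}" "\<And>n. r n \<le> norm (z n)"
    and cov: "{x \<in> Z. norm x = 1} \<subseteq> (\<Union>n::nat. ball (z n) (r n))"
    unfolding BCP_def by blast
  have "\<exists>n. sees (z n) x" if x: "x \<in> Z" "x \<noteq> 0" for x
  proof -
    have "(1 / norm x) *\<^sub>R x \<in> {x \<in> Z. norm x = 1}" using x Z by (simp add: subspace_scale)
    then obtain n where "norm (z n - (1 / norm x) *\<^sub>R x) < r n" using cov by (auto simp: dist_norm)
    then have "norm (z n - (1 / norm x) *\<^sub>R x) < norm (z n)" using zr(2)[of n] by linarith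
    then show ?thesis using x by (auto simp: sees_def intro!: exI[of _ n] exI[of _ "1 / norm x"])
  qed
  then have "sees_all (range z) Z" by (auto simp: sees_all_def)
  then show "\<exists>A. countable A \<and> A \<subseteq> Z \<and> sees_all A Z"
    using zr(1) by (intro exI[of _ "range z"]) auto
next
  assume "\<exists>A. countable A \<and> A \<subseteq> Z \<and> sees_all A Z"
  then obtain A where A: "countable A" "A \<subseteq> Z" "sees_all A Z" by blast
  define B where "B = (\<lambda>(k, z). real (Suc k) *\<^sub>R z) ` (UNIV \<times> (A - {0}))"
  have cB: "countable B" unfolding B_def using A by auto
  have BZ: "B \<subseteq> Z - {0}" using A Z by (auto simp: B_def subspace_scale)
  have cov: "\<exists>b\<in>B. norm (b - x) < norm b" if x: "x \<in> Z" "x \<noteq> 0" for x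
  proof -
    obtain z where z: "z \<in> A" "sees z x" using A(3) x by (auto simp: sees_all_def)
    obtain s0 c where s: "s0 > 0" "c > 0"
      "\<And>s. 0 \<le> s \<Longrightarrow> s \<le> s0 \<Longrightarrow> norm (z - s *\<^sub>R x) \<le> norm z - s * c"
      using sees_rate[OF z(2)] by blast
    obtain k where k: "1 / real (Suc k) < s0" using s(1) nat_approx_posE by blast
    have "0 < 1 / real (Suc k)" by simp
    then have "0 < 1 / real (Suc k) * c" using s(2) by (rule mult_pos_pos)
    then have "norm (z - (1 / real (Suc k)) *\<^sub>R x) < norm z" using s(3)[of "1 / real (Suc k)"] k by simp
    then have "real (Suc k) * norm (z - (1 / real (Suc k)) *\<^sub>R x) < real (Suc k) * norm z"
      by (intro mult_strict_left_mono) auto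
    moreover have "real (Suc k) * norm (z - (1 / real (Suc k)) *\<^sub>R x) = norm (real (Suc k) *\<^sub>R z - x)"
      using norm_scaleR[of "real (Suc k)" "z - (1 / real (Suc k)) *\<^sub>R x"]
      by (simp del: of_nat_Suc norm_scaleR add: scaleR_diff_right)
    moreover have "real (Suc k) *\<^sub>R z \<in> B" using z sees_nonzero(1)[OF z(2)] by (force simp: B_def)
    ultimately show ?thesis by (intro bexI[of _ "real (Suc k) *\<^sub>R z"]) (auto simp del: of_nat_Suc)
  qed
  obtain x where "x \<in> Z" "x \<noteq> 0" using nz subspace_0[OF Z] by blast
  then have "B \<noteq> {}" using cov by blast
  then have rng: "range (from_nat_into B) = B" using cB by (rule range_from_nat_into)
  show "BCP Z" unfolding BCP_def
  proof (intro exI conjI allI)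
    show "from_nat_into B n \<in> Z - {0}" for n using BZ rng by blast
    then show "0 < norm (from_nat_into B n)" for n by simp
    show "{x \<in> Z. norm x = 1} \<subseteq> (\<Union>n. ball (from_nat_into B n) (norm (from_nat_into B n)))"
    proof
      fix x assume "x \<in> {x \<in> Z. norm x = 1}"
      then obtain b where b: "b \<in> B" "norm (b - x) < norm b" using cov[of x] by force
      then obtain n where "b = from_nat_into B n" using rng by blast
      then show "x \<in> (\<Union>n. ball (from_nat_into B n) (norm (from_nat_into B n)))"
        using b by (auto simp: dist_norm)
    qed
  qed simp
qed

text \<open>Being seen is an open condition on the centre, so the centres may be moved into any dense
  set. How far depends on the point that is seen; hence each centre is replaced by a whole sequence
  converging to it.\<close>

lemma sees_all_dense:
  fixes A :: "'a::real_normed_vector set"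
  assumes A: "countable A" "sees_all A Z" and D: "closure D = UNIV"
  obtains B where "countable B" "B \<subseteq> D" "sees_all B Z"
proof -
  have "\<exists>d\<in>D. dist d z < 1 / real (Suc k)" for z k
    using D closure_approachable[of z D] by simp
  then obtain d where d: "\<And>z k. d z k \<in> D" "\<And>z k. dist (d z k) z < 1 / real (Suc k)" by metis
  define B where "B = (\<lambda>(z, k). d z k) ` (A \<times> UNIV)"
  have "\<exists>b\<in>B. sees b x" if x: "x \<in> Z - {0}" for x
  proof -
    obtain z where z: "z \<in> A" "sees z x" using A(2) x by (auto simp: sees_all_def)
    then obtain s where s: "s > 0" "norm (z - s *\<^sub>R x) < norm z" by (auto simp: sees_def)
    define e where "e = (norm z - norm (z - s *\<^sub>R x)) / 2"
    have "e > 0" using s by (simp add: e_def)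
    then obtain k where "1 / real (Suc k) < e" using nat_approx_posE by blast
    then have close: "norm (d z k - z) < e" using d(2)[of z k] by (simp add: dist_norm)
    have "norm (d z k - s *\<^sub>R x) \<le> norm (d z k - z) + norm (z - s *\<^sub>R x)"
      using norm_triangle_ineq[of "d z k - z" "z - s *\<^sub>R x"] by simp
    moreover have "norm z \<le> norm (d z k) + norm (d z k - z)" using norm_triangle_sub[of z "d z k"]
      by (simp add: norm_minus_commute)
    ultimately have "norm (d z k - s *\<^sub>R x) < norm (d z k)" using close unfolding e_def by argo
    then show ?thesis using s z by (auto simp: sees_def B_def)
  qed
  moreover have "countable B" "B \<subseteq> D" using A d by (auto simp: B_def)
  ultimately show ?thesis using that by (auto simp: sees_all_def)
qed

section \<open>Passing the property to the dual and to the range space\<close>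

lemma sees_contraction:
  assumes "sees z x"
  obtains e where "e > 0"
    "\<And>L. linear L \<Longrightarrow> (\<And>v. norm (L v) \<le> norm v) \<Longrightarrow> norm (L z) > norm z - e \<Longrightarrow> sees (L z) (L x)"
proof -
  obtain s where s: "s > 0" "norm (z - s *\<^sub>R x) < norm z" using assms by (auto simp: sees_def)
  show ?thesis
  proof (rule that)
    show "norm z - norm (z - s *\<^sub>R x) > 0" using s by simp
    fix L :: "'a \<Rightarrow> 'b"
    assume L: "linear L" "\<And>v. norm (L v) \<le> norm v" "norm (L z) > norm z - (norm z - norm (z - s *\<^sub>R x))"
    have "L (z - s *\<^sub>R x) = L z - s *\<^sub>R L x" by (simp add: linear_diff linear_scale L(1))
    then have "norm (L z - s *\<^sub>R L x) < norm (L z)" using L(2)[of "z - s *\<^sub>R x"] L(3) by simp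
    then show "sees (L z) (L x)" using s by (auto simp: sees_def)
  qed
qed

text \<open>A contraction that almost preserves the norm of a centre keeps the descent of the norm, so
  the images of the centres see the images of the points. If moreover all these contractions map
  some single nonzero point of \<open>W\<close> to multiples of \<open>v\<close>, then \<open>v\<close> is seen up to a sign. How well the
  norm must be preserved depends on the point, hence the index \<open>k\<close>.\<close>

lemma BCP_transfer:
  fixes W :: "'a::real_normed_vector set" and L :: "'a \<Rightarrow> nat \<Rightarrow> 'a \<Rightarrow> 'b::real_normed_vector"
  assumes W: "subspace W" "BCP W" and nz: "(UNIV :: 'b set) \<noteq> {0}"
    and lin: "\<And>z k. linear (L z k)" and con: "\<And>z k v. norm (L z k v) \<le> norm v"
    and near: "\<And>z k. norm (L z k z) > norm z - 1 / real (Suc k)"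
    and hit: "\<And>v. v \<noteq> 0 \<Longrightarrow> \<exists>x\<in>W - {0}. \<forall>z k. \<exists>c. L z k x = c *\<^sub>R v"
  shows "BCP (UNIV :: 'b set)"
proof -
  obtain v :: 'b where "v \<noteq> 0" using nz by blast
  then have "W \<noteq> {0}" using hit by blast
  then obtain A where A: "countable A" "sees_all A W" using BCP_iff_sees_all W by blast
  define B where "B = (\<lambda>(z, k). L z k z) ` (A \<times> UNIV)"
  have "countable (B \<union> uminus ` B)" using A by (auto simp: B_def)
  moreover have "sees_all (B \<union> uminus ` B) UNIV" unfolding sees_all_def
  proof
    fix v :: 'b assume "v \<in> UNIV - {0}"
    then have "v \<noteq> 0" by simp
    then obtain x where x: "x \<in> W - {0}" "\<And>z k. \<exists>c. L z k x = c *\<^sub>R v" using hit[of v] by blast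
    then obtain z where z: "z \<in> A" "sees z x" using A(2) unfolding sees_all_def by blast
    obtain e where e: "e > 0"
      "\<And>L :: 'a \<Rightarrow> 'b. linear L \<Longrightarrow> (\<And>v. norm (L v) \<le> norm v) \<Longrightarrow> norm (L z) > norm z - e \<Longrightarrow> sees (L z) (L x)"
      using sees_contraction[OF z(2)] by blast
    obtain k where k: "1 / real (Suc k) < e" using e(1) nat_approx_posE by blast
    have "norm (L z k z) > norm z - e" using near[of z k] k by linarith
    then have "sees (L z k z) (L z k x)" by (intro e(2) lin con)
    moreover obtain c where "L z k x = c *\<^sub>R v" using x(2) by blast
    ultimately have "sees (L z k z) v \<or> sees (- L z k z) v" using sees_scaleR_right by metis
    moreover have "L z k z \<in> B" using z by (auto simp: B_def)
    ultimately show "\<exists>z\<in>B \<union> uminus ` B. sees z v" by blast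
  qed
  ultimately show ?thesis using BCP_iff_sees_all[OF subspace_UNIV nz] by blast
qed

lemma norm_blinfun_le_ball:
  fixes F :: "'a::real_normed_vector \<Rightarrow>\<^sub>L 'b::real_normed_vector"
  assumes "\<And>u. norm u \<le> 1 \<Longrightarrow> norm (F u) \<le> B"
  shows "norm F \<le> B"
proof (rule norm_blinfun_bound)
  show "0 \<le> B" using assms[of 0] by simp
  fix x
  show "norm (F x) \<le> B * norm x"
  proof (cases "x = 0")
    case False
    have "norm (F ((1 / norm x) *\<^sub>R x)) \<le> B" using False by (intro assms) simp
    then show ?thesis using False by (simp add: blinfun.scaleR_right field_simps)
  qed simp
qed

lemma blinfun_almost_attains_norm:
  fixes F :: "'a::real_normed_vector \<Rightarrow>\<^sub>L 'b::real_normed_vector"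
  assumes "e > 0"
  shows "\<exists>u. norm u \<le> 1 \<and> norm (F u) > norm F - e"
proof (rule ccontr)
  assume "\<not> ?thesis"
  then have "norm F \<le> norm F - e" by (intro norm_blinfun_le_ball) force
  then show False using assms by simp
qed

text \<open>The adjoint of an operator has at least the norm of the operator.\<close>

lemma adjoint_almost_attains_norm:
  fixes F :: "'a::real_normed_vector \<Rightarrow>\<^sub>L 'b::real_normed_vector"
  assumes "e > 0"
  shows "\<exists>g :: 'b \<Rightarrow>\<^sub>L real. norm g \<le> 1 \<and> norm (g o\<^sub>L F) > norm F - e"
proof -
  obtain u where u: "norm u \<le> 1" "norm (F u) > norm F - e"
    using blinfun_almost_attains_norm[OF assms] by blast
  obtain g :: "'b \<Rightarrow>\<^sub>L real" where g: "norm g \<le> 1" "g (F u) = norm (F u)"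
    using ex_support_functional by blast
  have "norm ((g o\<^sub>L F) u) \<le> norm (g o\<^sub>L F) * norm u" by (rule norm_blinfun)
  also have "\<dots> \<le> norm (g o\<^sub>L F)" using u(1) by (simp add: mult_left_le)
  finally show ?thesis using u g by (intro exI[of _ g]) auto
qed

definition rank_one :: "('a::real_normed_vector \<Rightarrow>\<^sub>L real) \<Rightarrow> 'b::real_normed_vector \<Rightarrow> ('a \<Rightarrow>\<^sub>L 'b)" where
  "rank_one f y = blinfun_scaleR_left y o\<^sub>L f"

lemma rank_one_apply [simp]: "rank_one f y u = f u *\<^sub>R y"
  by (simp add: rank_one_def)

lemma norm_rank_one: "norm (rank_one f y) = norm f * norm y"
proof (rule order_antisym)
  show "norm (rank_one f y) \<le> norm f * norm y"
  proof (rule norm_blinfun_bound)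
    show "norm (rank_one f y u) \<le> norm f * norm y * norm u" for u
      using norm_blinfun[of f u] mult_right_mono[of "\<bar>f u\<bar>" "norm f * norm u" "norm y"]
      by (simp add: mult_ac)
  qed simp
  show "norm f * norm y \<le> norm (rank_one f y)"
  proof (cases "y = 0")
    case False
    have "norm f \<le> norm (rank_one f y) / norm y"
    proof (rule norm_blinfun_bound)
      show "norm (f u) \<le> norm (rank_one f y) / norm y * norm u" for u
        using norm_blinfun[of "rank_one f y" u] False by (simp add: field_simps)
    qed simp
    then show ?thesis using False by (simp add: field_simps)
  qed simp
qed

lemma rank_one_finite_rank: "rank_one f y \<in> finite_rank_ops"
  unfolding finite_rank_ops_def by (auto intro!: exI[of _ "{y}"] simp: span_singleton intro: rangeI)

lemma BCP_range_of_BCP_operators: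
  fixes W :: "('a::real_normed_vector \<Rightarrow>\<^sub>L 'b::real_normed_vector) set"
  assumes nz: "(UNIV :: 'a set) \<noteq> {0}" "(UNIV :: 'b set) \<noteq> {0}"
    and W: "subspace W" "finite_rank_ops \<subseteq> W" "BCP W"
  shows "BCP (UNIV :: 'b set)"
proof -
  have "\<exists>u. norm u \<le> 1 \<and> norm (blinfun_apply F u) > norm F - 1 / real (Suc k)" for F :: "'a \<Rightarrow>\<^sub>L 'b" and k
    by (rule blinfun_almost_attains_norm) simp
  then obtain u :: "('a \<Rightarrow>\<^sub>L 'b) \<Rightarrow> nat \<Rightarrow> 'a" where u: "\<And>F k. norm (u F k) \<le> 1"
    "\<And>F k. norm (blinfun_apply F (u F k)) > norm F - 1 / real (Suc k)" by metis
  obtain x0 :: 'a where x0: "x0 \<noteq> 0" using nz by blast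
  obtain f0 :: "'a \<Rightarrow>\<^sub>L real" where "f0 x0 = norm x0" using ex_support_functional by blast
  then have f0: "f0 \<noteq> 0" using x0 by auto
  show ?thesis
  proof (rule BCP_transfer[where L = "\<lambda>F k G. blinfun_apply G (u F k)", OF W(1,3) nz(2)])
    show "linear (\<lambda>G. blinfun_apply G (u F k))" for F k
      by (intro linearI) (auto simp: blinfun.add_left blinfun.scaleR_left)
    show "norm (blinfun_apply G (u F k)) \<le> norm G" for F G k
      using norm_blinfun[of G "u F k"] mult_left_le[OF u(1)[of F k] norm_ge_zero[of G]] by linarith
    show "\<exists>G\<in>W - {0}. \<forall>F k. \<exists>c. blinfun_apply G (u F k) = c *\<^sub>R v" if "v \<noteq> 0" for v
    proof (intro bexI allI exI)
      show "blinfun_apply (rank_one f0 v) (u F k) = f0 (u F k) *\<^sub>R v" for F k by simp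
      have "norm (rank_one f0 v) \<noteq> 0" using that f0 by (simp add: norm_rank_one)
      then show "rank_one f0 v \<in> W - {0}" using W rank_one_finite_rank by auto
    qed
  qed (rule u(2))
qed

lemma BCP_dual_of_BCP_operators:
  fixes W :: "('a::real_normed_vector \<Rightarrow>\<^sub>L 'b::real_normed_vector) set"
  assumes nz: "(UNIV :: 'a set) \<noteq> {0}" "(UNIV :: 'b set) \<noteq> {0}"
    and W: "subspace W" "finite_rank_ops \<subseteq> W" "BCP W"
  shows "BCP (UNIV :: ('a \<Rightarrow>\<^sub>L real) set)"
proof -
  have "\<exists>g :: 'b \<Rightarrow>\<^sub>L real. norm g \<le> 1 \<and> norm (g o\<^sub>L F) > norm F - 1 / real (Suc k)"
    for F :: "'a \<Rightarrow>\<^sub>L 'b" and k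
    by (rule adjoint_almost_attains_norm) simp
  then obtain g :: "('a \<Rightarrow>\<^sub>L 'b) \<Rightarrow> nat \<Rightarrow> ('b \<Rightarrow>\<^sub>L real)" where g: "\<And>F k. norm (g F k) \<le> 1"
    "\<And>F k. norm (g F k o\<^sub>L F) > norm F - 1 / real (Suc k)" by metis
  obtain x0 :: 'a where x0: "x0 \<noteq> 0" using nz by blast
  obtain f0 :: "'a \<Rightarrow>\<^sub>L real" where "f0 x0 = norm x0" using ex_support_functional by blast
  then have f0: "f0 \<noteq> 0" using x0 by auto
  obtain y0 :: 'b where y0: "y0 \<noteq> 0" using nz by blast
  show ?thesis
  proof (rule BCP_transfer[where L = "\<lambda>F k G. g F k o\<^sub>L G", OF W(1,3)])
    show "(UNIV :: ('a \<Rightarrow>\<^sub>L real) set) \<noteq> {0}" using f0 by auto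
    show "linear (\<lambda>G. g F k o\<^sub>L G)" for F k
      by (intro linearI) (auto intro!: blinfun_eqI simp: blinfun.bilinear_simps)
    show "norm (g F k o\<^sub>L G) \<le> norm G" for F G k
      using norm_blinfun_compose[of "g F k" G] mult_right_mono[OF g(1)[of F k] norm_ge_zero[of G]]
      by simp
    show "\<exists>G\<in>W - {0}. \<forall>F k. \<exists>c. g F k o\<^sub>L G = c *\<^sub>R f" if "f \<noteq> 0" for f
    proof (intro bexI allI exI)
      show "g F k o\<^sub>L rank_one f y0 = g F k y0 *\<^sub>R f" for F k
        by (rule blinfun_eqI) (simp add: blinfun.bilinear_simps)
      have "norm (rank_one f y0) \<noteq> 0" using that y0 by (simp add: norm_rank_one)
      then show "rank_one f y0 \<in> W - {0}" using W rank_one_finite_rank by auto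
    qed
  qed (rule g(2))
qed

section \<open>Rank-one operators as centres\<close>

text \<open>Only points \<open>u\<close> at which \<open>f\<close> almost attains its norm matter for the norm of a small
  perturbation of \<open>rank_one f y\<close>: elsewhere \<open>f u *\<^sub>R y\<close> is shorter by a fixed amount. Replacing \<open>u\<close>
  by \<open>- u\<close> makes \<open>f u\<close> nonnegative.\<close>

lemma rank_one_seesI:
  fixes T :: "'a::real_normed_vector \<Rightarrow>\<^sub>L 'b::real_normed_vector" and f :: "'a \<Rightarrow>\<^sub>L real"
  assumes y: "y \<noteq> 0" and pos: "k > 0" "d > 0" "s0 > 0"
    and near: "\<And>s u. 0 < s \<Longrightarrow> s \<le> s0 \<Longrightarrow> norm u \<le> 1 \<Longrightarrow> f u \<ge> 0 \<Longrightarrow> f u > norm f - d \<Longrightarrow>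
      norm (f u *\<^sub>R y - s *\<^sub>R T u) \<le> norm f * norm y - s * k"
  shows "sees (rank_one f y) T"
proof -
  define s where "s = min s0 (d * norm y / (2 * (norm T + 1)))"
  have T1: "norm T + 1 > 0" using norm_ge_zero[of T] by linarith
  have s: "0 < s" "s \<le> s0" using pos y T1 by (auto simp: s_def)
  have "s \<le> d * norm y / (2 * (norm T + 1))" by (simp add: s_def)
  then have "s * (norm T + 1) \<le> d * norm y / 2" using T1 by (simp add: field_simps)
  then have sT: "s * norm T \<le> d * norm y / 2" using s(1) by (simp add: algebra_simps)
  define m where "m = min (s * k) (d * norm y / 2)"
  have m: "m > 0" using s pos y by (auto simp: m_def)
  have half: "norm (f u *\<^sub>R y - s *\<^sub>R T u) \<le> norm f * norm y - m" if u: "norm u \<le> 1" "f u \<ge> 0" for u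
  proof (cases "f u > norm f - d")
    case True
    then show ?thesis using near[OF s u] by (simp add: m_def)
  next
    case False
    have "norm (T u) \<le> norm T"
      using norm_blinfun[of T u] mult_left_le[OF u(1) norm_ge_zero[of T]] by linarith
    then have "s * norm (T u) \<le> d * norm y / 2" using sT s(1) by (meson mult_left_mono less_imp_le order_trans)
    moreover have "norm (f u *\<^sub>R y - s *\<^sub>R T u) \<le> f u * norm y + s * norm (T u)"
      using norm_triangle_ineq4[of "f u *\<^sub>R y" "s *\<^sub>R T u"] u s by simp
    moreover have "f u * norm y \<le> (norm f - d) * norm y" using False by (intro mult_right_mono) auto
    ultimately have "norm (f u *\<^sub>R y - s *\<^sub>R T u) \<le> norm f * norm y - d * norm y / 2"
      by (simp add: algebra_simps)
    then show ?thesis by (simp add: m_def)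
  qed
  have "norm (rank_one f y - s *\<^sub>R T) \<le> norm f * norm y - m"
  proof (rule norm_blinfun_le_ball)
    fix u :: 'a assume u: "norm u \<le> 1"
    have eq: "(rank_one f y - s *\<^sub>R T) u = f u *\<^sub>R y - s *\<^sub>R T u"
      by (simp add: blinfun.bilinear_simps)
    have "norm (f u *\<^sub>R y - s *\<^sub>R T u) \<le> norm f * norm y - m"
    proof (cases "f u \<ge> 0")
      case False
      have "norm (f (- u) *\<^sub>R y - s *\<^sub>R T (- u)) = norm (f u *\<^sub>R y - s *\<^sub>R T u)"
        by (simp add: blinfun.minus_right norm_minus_commute)
      moreover have "f (- u) \<ge> 0" using False by (simp add: blinfun.minus_right)
      ultimately show ?thesis using half[of "- u"] u by simp
    qed (use half u in auto)
    then show "norm ((rank_one f y - s *\<^sub>R T) u) \<le> norm f * norm y - m" using eq by simp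
  qed
  then show ?thesis using s(1) m by (auto simp: sees_def norm_rank_one)
qed

text \<open>A sequence violating the estimate would contradict strong exposure. Elements of \<open>SE\<close> may be
  negative multiples of strongly exposing functionals; the sign is absorbed into the point.\<close>

lemma SE_exposes:
  fixes f :: "'a::real_normed_vector \<Rightarrow>\<^sub>L real"
  assumes "f \<in> SE"
  obtains x where "norm x = 1" "f x = norm f" "f \<noteq> 0"
    "\<And>e. e > 0 \<Longrightarrow> \<exists>d>0. \<forall>u. norm u \<le> 1 \<longrightarrow> f u > norm f - d \<longrightarrow> norm (u - x) < e"
proof -
  obtain c g x0 where c: "c \<noteq> 0" "f = c *\<^sub>R g" and g: "strongly_exposes g x0"
    using assms by (auto simp: SE_def SE_ball_def)
  have g1: "norm g = 1" "norm x0 = 1" "g x0 = 1"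
    and seq: "\<And>s :: nat \<Rightarrow> 'a. (\<And>n. norm (s n) \<le> 1) \<Longrightarrow> (\<lambda>n. g (s n)) \<longlonglongrightarrow> 1 \<Longrightarrow> s \<longlonglongrightarrow> x0"
    using g by (auto simp: strongly_exposes_def)
  have exp: "\<exists>d>0. \<forall>u. norm u \<le> 1 \<longrightarrow> g u > 1 - d \<longrightarrow> norm (u - x0) < e" if e: "e > 0" for e
  proof (rule ccontr)
    assume "\<not> ?thesis"
    then have "\<exists>u. norm u \<le> 1 \<and> g u > 1 - 1 / real (Suc n) \<and> \<not> norm (u - x0) < e" for n
      by (metis zero_less_divide_1_iff of_nat_0_less_iff zero_less_Suc)
    then obtain u where u: "\<And>n. norm (u n) \<le> 1" "\<And>n. g (u n) > 1 - 1 / real (Suc n)"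
      "\<And>n. \<not> norm (u n - x0) < e" by metis
    have le1: "g (u n) \<le> 1" for n using norm_blinfun[of g "u n"] u(1)[of n] g1 by simp
    have "(\<lambda>n. g (u n)) \<longlonglongrightarrow> 1"
    proof (rule tendsto_sandwich[where h = "\<lambda>n. 1" and f = "\<lambda>n. 1 - 1 / real (Suc n)"])
      show "(\<lambda>n. 1 - 1 / real (Suc n)) \<longlonglongrightarrow> 1"
        using tendsto_diff[OF tendsto_const[of 1] LIMSEQ_inverse_real_of_nat] by (simp add: inverse_eq_divide)
      show "\<forall>\<^sub>F n in sequentially. 1 - 1 / real (Suc n) \<le> g (u n)"
        by (intro always_eventually allI less_imp_le u(2))
    qed (use le1 in auto)
    then have "u \<longlonglongrightarrow> x0" using u(1) by (intro seq)
    then obtain n where "norm (u n - x0) < e" using e LIMSEQ_D[of u x0 e] by blast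
    then show False using u(3) by blast
  qed
  define x where "x = sgn c *\<^sub>R x0"
  have nf: "norm f = \<bar>c\<bar>" using c g1 by simp
  show ?thesis
  proof (rule that)
    show "norm x = 1" using c g1 by (simp add: x_def sgn_if)
    show "f x = norm f" using c g1 nf
      by (simp add: x_def blinfun.bilinear_simps abs_sgn)
    show "f \<noteq> 0" using c g1 by auto
    fix e :: real assume "e > 0"
    then obtain d where d: "d > 0" "\<And>u. norm u \<le> 1 \<Longrightarrow> g u > 1 - d \<Longrightarrow> norm (u - x0) < e"
      using exp by blast
    have "norm (u - x) < e" if u: "norm u \<le> 1" "f u > norm f - \<bar>c\<bar> * d" for u
    proof -
      have "\<bar>c\<bar> * g (sgn c *\<^sub>R u) = f u" using c by (simp add: blinfun.bilinear_simps abs_sgn)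
      then have "\<bar>c\<bar> * g (sgn c *\<^sub>R u) > \<bar>c\<bar> * (1 - d)" using u(2) nf by (simp add: algebra_simps)
      then have "g (sgn c *\<^sub>R u) > 1 - d" using c by simp
      moreover have "norm (sgn c *\<^sub>R u) \<le> 1" using u(1) c by (simp add: sgn_if)
      ultimately have "norm (sgn c *\<^sub>R u - x0) < e" using d(2) by blast
      moreover have "u - x = sgn c *\<^sub>R (sgn c *\<^sub>R u - x0)"
        using c by (simp add: x_def scaleR_diff_right sgn_if)
      ultimately show ?thesis using c by (simp add: sgn_if split: if_splits)
    qed
    then show "\<exists>d>0. \<forall>u. norm u \<le> 1 \<longrightarrow> f u > norm f - d \<longrightarrow> norm (u - x) < e"
      using d(1) c by (intro exI[of _ "\<bar>c\<bar> * d"]) auto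
  qed
qed

text \<open>If \<open>f\<close> strongly exposes \<open>x\<close>, then the points where \<open>f\<close> almost attains its norm are close to
  \<open>x\<close>, so \<open>T u\<close> may be replaced by \<open>T x\<close> at the cost of a small fraction of the step.\<close>

lemma rank_one_sees_exposing:
  fixes T :: "'a::real_normed_vector \<Rightarrow>\<^sub>L 'b::real_normed_vector" and f :: "'a \<Rightarrow>\<^sub>L real"
  assumes x: "norm x = 1" and f0: "f \<noteq> 0"
    and exp: "\<And>e. e > 0 \<Longrightarrow> \<exists>d>0. \<forall>u. norm u \<le> 1 \<longrightarrow> f u > norm f - d \<longrightarrow> norm (u - x) < e"
    and y: "sees y (T x)"
  shows "sees (rank_one f y) T"
proof -
  define c where "c = norm f"
  have c: "c > 0" using f0 by (simp add: c_def)
  obtain s0 k where s0: "s0 > 0" "k > 0"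
    and rate: "\<And>s. 0 \<le> s \<Longrightarrow> s \<le> s0 \<Longrightarrow> norm (c *\<^sub>R y - s *\<^sub>R T x) \<le> norm (c *\<^sub>R y) - s * k"
    using sees_rate[OF sees_scaleR_left[OF y c]] by blast
  have T1: "norm T + 1 > 0" using norm_ge_zero[of T] by linarith
  obtain d where d: "d > 0" "\<And>u. norm u \<le> 1 \<Longrightarrow> f u > c - d \<Longrightarrow> norm (u - x) < k / 2 / (norm T + 1)"
    using exp[of "k / 2 / (norm T + 1)"] s0 T1 unfolding c_def by auto
  show ?thesis
  proof (rule rank_one_seesI)
    show "y \<noteq> 0" using y sees_nonzero by blast
    show "k / 2 > 0" "min d (c / 2) > 0" "s0 / 2 > 0" using s0 d c by auto
    fix s u
    assume s: "0 < s" "s \<le> s0 / 2" and u: "norm u \<le> 1" "f u > norm f - min d (c / 2)"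
    \<comment> \<open>\<open>f u *\<^sub>R y\<close> is slightly shorter than \<open>c *\<^sub>R y\<close>; rescaling by \<open>l\<close> turns the step \<open>s\<close> into \<open>s / l\<close>,
      which stays below \<open>s0\<close> because \<open>l > 1 / 2\<close>\<close>
    define l where "l = f u / c"
    have "f u \<le> c" using norm_blinfun[of f u] mult_left_le[OF u(1) norm_ge_zero[of f]] by (simp add: c_def)
    then have l: "l > 1/2" "l \<le> 1" "f u = l * c" using u c by (auto simp: l_def c_def[symmetric] field_simps)
    have "s / l \<le> s / (1/2)" using l s by (intro divide_left_mono) auto
    then have sl: "0 \<le> s / l" "s / l \<le> s0" using l s by auto
    have "f u *\<^sub>R y - s *\<^sub>R T x = l *\<^sub>R (c *\<^sub>R y - (s / l) *\<^sub>R T x)"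
      using l by (simp add: scaleR_diff_right)
    then have "norm (f u *\<^sub>R y - s *\<^sub>R T x) = l * norm (c *\<^sub>R y - (s / l) *\<^sub>R T x)" using l by simp
    also have "\<dots> \<le> l * (norm (c *\<^sub>R y) - (s / l) * k)" using l rate[OF sl] by (intro mult_left_mono) auto
    also have "\<dots> = l * (c * norm y) - s * k" using l c by (simp add: field_simps)
    also have "\<dots> \<le> c * norm y - s * k" using l c by (simp add: mult_left_le_one_le)
    finally have 1: "norm (f u *\<^sub>R y - s *\<^sub>R T x) \<le> c * norm y - s * k" .
    have "norm (u - x) < k / 2 / (norm T + 1)" using d u by (simp add: c_def)
    then have "(norm T + 1) * norm (u - x) \<le> k / 2" using T1 by (simp add: field_simps)
    then have "norm (T (u - x)) \<le> k / 2"
      using norm_blinfun[of T "u - x"] norm_ge_zero[of "u - x"] by (simp only: distrib_right mult_1)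
    then have "s * norm (T (u - x)) \<le> s * (k / 2)" using s by (intro mult_left_mono) auto
    moreover have split: "f u *\<^sub>R y - s *\<^sub>R T u = (f u *\<^sub>R y - s *\<^sub>R T x) - s *\<^sub>R T (u - x)"
      by (simp add: blinfun.diff_right algebra_simps)
    have "norm (f u *\<^sub>R y - s *\<^sub>R T u) \<le> norm (f u *\<^sub>R y - s *\<^sub>R T x) + s * norm (T (u - x))"
      unfolding split using norm_triangle_ineq4[of "f u *\<^sub>R y - s *\<^sub>R T x" "s *\<^sub>R T (u - x)"] s by simp
    ultimately show "norm (f u *\<^sub>R y - s *\<^sub>R T u) \<le> norm f * norm y - s * (k / 2)"
      using 1 by (simp add: c_def)
  qed
qed

text \<open>The difference quotient in direction \<open>z\<close> is at least \<open>g z\<close> for \<open>t > 0\<close> and at most \<open>g z\<close> for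
  \<open>t < 0\<close>, because \<open>g\<close> supports the norm at \<open>y\<close>. So the two-sided limit is \<open>g\<close>, and the uniformity of
  the limit is the estimate.\<close>

lemma frechet_uniform_descent:
  fixes y :: "'a::real_normed_vector" and g :: "'a \<Rightarrow>\<^sub>L real"
  assumes y: "norm_frechet_differentiable_at y" and g: "norm g \<le> 1" "g y = norm y" and e: "e > 0"
  shows "\<exists>d>0. \<forall>z. norm z < d \<longrightarrow> norm (y - z) \<le> norm y - g z + e * norm z"
proof -
  let ?q = "\<lambda>t z. (norm (y + t *\<^sub>R z) - norm y) / t"
  obtain D where lim: "\<And>z. ((\<lambda>t. ?q t z) \<longlongrightarrow> D z) (at 0)"
    and unif: "uniform_limit (sphere 0 1) ?q D (at 0)"
    using y unfolding norm_frechet_differentiable_at_def by blast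
  have supp: "g v \<le> norm v" for v
    using norm_blinfun[of g v] mult_right_mono[OF g(1) norm_ge_zero[of v]] by simp
  have D_ge: "D z \<ge> g z" for z
  proof (rule tendsto_lowerbound)
    show "((\<lambda>t. ?q t z) \<longlongrightarrow> D z) (at_right 0)" using lim by (rule filterlim_mono) (auto simp: at_le)
    have "g z \<le> ?q t z" if "t > 0" for t
      using supp[of "y + t *\<^sub>R z"] g(2) that by (simp add: blinfun.bilinear_simps field_simps)
    then show "\<forall>\<^sub>F t in at_right 0. g z \<le> ?q t z" by (auto simp: eventually_at_filter)
  qed simp
  have D_le: "D z \<le> g z" for z
  proof (rule tendsto_upperbound)
    show "((\<lambda>t. ?q t z) \<longlongrightarrow> D z) (at_left 0)" using lim by (rule filterlim_mono) (auto simp: at_le)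
    have "?q t z \<le> g z" if "t < 0" for t
      using supp[of "y + t *\<^sub>R z"] g(2) that by (simp add: blinfun.bilinear_simps field_simps)
    then show "\<forall>\<^sub>F t in at_left 0. ?q t z \<le> g z" by (auto simp: eventually_at_filter)
  qed simp
  have Dg: "D z = g z" for z using D_ge[of z] D_le[of z] by linarith
  obtain d where d: "d > 0" "\<And>t z. t \<noteq> 0 \<Longrightarrow> \<bar>t\<bar> < d \<Longrightarrow> norm z = 1 \<Longrightarrow> \<bar>?q t z - g z\<bar> < e"
    using uniform_limitD[OF unif e] by (auto simp: eventually_at dist_real_def Dg)
  have "norm (y - z) \<le> norm y - g z + e * norm z" if z: "norm z < d" for z
  proof (cases "z = 0")
    case False
    define n where "n = norm z"
    define w where "w = (1 / n) *\<^sub>R z"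
    have n: "n > 0" and w: "norm w = 1" and zw: "z = n *\<^sub>R w" using False by (auto simp: n_def w_def)
    have "\<bar>?q (- n) w - g w\<bar> < e" using n w z by (intro d(2)) (auto simp: n_def)
    moreover have "?q (- n) w = (norm y - norm (y - z)) / n" using n zw by (simp add: field_simps)
    ultimately have "(norm y - norm (y - z)) / n > g w - e" by linarith
    then have "norm y - norm (y - z) > n * (g w - e)" using n by (simp add: field_simps)
    moreover have "g z = n * g w" by (simp add: zw blinfun.scaleR_right)
    ultimately show ?thesis by (simp add: algebra_simps n_def[symmetric])
  qed simp
  then show ?thesis using d(1) by blast
qed

text \<open>At a Frechet smooth point \<open>y\<close> the norm of \<open>f u *\<^sub>R y - s *\<^sub>R T u\<close> is, uniformly in \<open>u\<close> and up
  to a small fraction of \<open>s\<close>, the value at \<open>u\<close> of the functional \<open>norm y *\<^sub>R f - s *\<^sub>R (g o\<^sub>L T)\<close>. The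
  latter has small norm because \<open>f\<close> sees \<open>g o\<^sub>L T\<close>.\<close>

lemma rank_one_sees_frechet:
  fixes T :: "'a::real_normed_vector \<Rightarrow>\<^sub>L 'b::real_normed_vector" and g :: "'b \<Rightarrow>\<^sub>L real"
  assumes y: "norm_frechet_differentiable_at y" and g: "norm g \<le> 1" "g y = norm y"
    and f: "sees f (g o\<^sub>L T)"
  shows "sees (rank_one f y) T"
proof -
  define c where "c = norm f"
  have c: "c > 0" using sees_nonzero(1)[OF f] by (simp add: c_def)
  have y0: "y \<noteq> 0" using y by (simp add: norm_frechet_differentiable_at_def)
  obtain s0 k where s0: "s0 > 0" "k > 0"
    and rate: "\<And>s. 0 \<le> s \<Longrightarrow> s \<le> s0 \<Longrightarrow>
      norm (norm y *\<^sub>R f - s *\<^sub>R (g o\<^sub>L T)) \<le> norm (norm y *\<^sub>R f) - s * k"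
    using sees_rate[OF sees_scaleR_left[OF f, of "norm y"]] y0 by auto
  have T1: "norm T + 1 > 0" using norm_ge_zero[of T] by linarith
  define e where "e = k / 2 / (norm T + 1)"
  have e: "e > 0" using s0 T1 by (simp add: e_def)
  have eT: "e * norm T \<le> k / 2" using s0 T1 by (simp add: e_def field_simps)
  obtain d where d: "d > 0" "\<And>z. norm z < d \<Longrightarrow> norm (y - z) \<le> norm y - g z + e * norm z"
    using frechet_uniform_descent[OF y g e] by blast
  \<comment> \<open>so that the displacement \<open>(s / f u) *\<^sub>R T u\<close> stays shorter than \<open>d\<close>, given \<open>f u > c / 2\<close>\<close>
  define s1 where "s1 = min s0 (d * c / (2 * (norm T + 1)))"
  show ?thesis
  proof (rule rank_one_seesI)
    show "y \<noteq> 0" by (rule y0)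
    show "k / 2 > 0" "c / 2 > 0" "s1 > 0" using s0 c d T1 by (auto simp: s1_def)
    fix s u
    assume s: "0 < s" "s \<le> s1" and u: "norm u \<le> 1" "f u > norm f - c / 2"
    have "f u > c / 2" using u by (simp add: c_def)
    then have fu: "f u > c / 2" "f u > 0" using c by linarith+
    have Tu: "norm (T u) \<le> norm T"
      using norm_blinfun[of T u] mult_left_le[OF u(1) norm_ge_zero[of T]] by linarith
    define z where "z = (s / f u) *\<^sub>R T u"
    have "s \<le> d * c / (2 * (norm T + 1))" using s by (simp add: s1_def)
    then have "s * (norm T + 1) \<le> d * (c / 2)" using T1 by (simp add: field_simps)
    also have "\<dots> < d * f u" using d(1) fu by simp
    finally have "s * (norm T + 1) < d * f u" .
    moreover have "s * norm (T u) \<le> s * (norm T + 1)" using s Tu by (intro mult_left_mono) auto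
    ultimately have "norm z < d" using fu s by (simp add: z_def field_simps)
    then have dz: "norm (y - z) \<le> norm y - g z + e * norm z" by (rule d(2))
    have "f u *\<^sub>R y - s *\<^sub>R T u = f u *\<^sub>R (y - z)" using fu by (simp add: z_def scaleR_diff_right)
    then have "norm (f u *\<^sub>R y - s *\<^sub>R T u) = f u * norm (y - z)" using fu by simp
    also have "\<dots> \<le> f u * (norm y - g z + e * norm z)" using dz fu by (intro mult_left_mono) auto
    also have "\<dots> = (f u * norm y - s * g (T u)) + s * (e * norm (T u))"
      using fu s by (simp add: z_def blinfun.scaleR_right field_simps)
    finally have 1: "norm (f u *\<^sub>R y - s *\<^sub>R T u) \<le> (f u * norm y - s * g (T u)) + s * (e * norm (T u))" .
    have "e * norm (T u) \<le> k / 2" using eT Tu e by (meson mult_left_mono less_imp_le order_trans)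
    then have 2: "s * (e * norm (T u)) \<le> s * (k / 2)" using s by (intro mult_left_mono) auto
    let ?h = "norm y *\<^sub>R f - s *\<^sub>R (g o\<^sub>L T)"
    have "f u * norm y - s * g (T u) = ?h u" by (simp add: blinfun.bilinear_simps)
    also have "\<dots> \<le> norm ?h"
      using norm_blinfun[of ?h u] mult_left_le[OF u(1) norm_ge_zero[of ?h]] by simp
    also have "\<dots> \<le> norm (norm y *\<^sub>R f) - s * k" using s by (intro rate) (auto simp: s1_def)
    finally have 3: "f u * norm y - s * g (T u) \<le> norm f * norm y - s * k" by (simp add: mult.commute)
    show "norm (f u *\<^sub>R y - s *\<^sub>R T u) \<le> norm f * norm y - s * (k / 2)" using 1 2 3 by simp
  qed
qed

section \<open>The characterisation\<close>

text \<open>A functional that sees \<open>g o\<^sub>L T\<close> and attains its norm at \<open>x\<close> forces \<open>T x \<noteq> 0\<close>: otherwise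
  subtracting multiples of \<open>g o\<^sub>L T\<close> would not change the value at \<open>x\<close>, and the norm could not drop.\<close>

lemma sees_all_rank_one_SE:
  fixes A :: "('a::real_normed_vector \<Rightarrow>\<^sub>L real) set" and B :: "'b::real_normed_vector set"
  assumes "A \<subseteq> SE" "sees_all A UNIV" "sees_all B UNIV"
  shows "sees_all ((\<lambda>(f, y). rank_one f y) ` (A \<times> B)) UNIV"
  unfolding sees_all_def
proof
  fix T :: "'a \<Rightarrow>\<^sub>L 'b" assume "T \<in> UNIV - {0}"
  then obtain v where v: "T v \<noteq> 0" using blinfun_eqI[of T 0] by auto
  obtain g :: "'b \<Rightarrow>\<^sub>L real" where "g (T v) = norm (T v)" using ex_support_functional by blast
  then have "(g o\<^sub>L T) v \<noteq> 0" using v by simp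
  then have "g o\<^sub>L T \<noteq> 0" by (metis blinfun.zero_left)
  then obtain f where f: "f \<in> A" "sees f (g o\<^sub>L T)" using assms(2) by (auto simp: sees_all_def)
  obtain x where x: "norm x = 1" "f x = norm f" "f \<noteq> 0"
    "\<And>e. e > 0 \<Longrightarrow> \<exists>d>0. \<forall>u. norm u \<le> 1 \<longrightarrow> f u > norm f - d \<longrightarrow> norm (u - x) < e"
    using SE_exposes f(1) assms(1) by blast
  obtain s where s: "norm (f - s *\<^sub>R (g o\<^sub>L T)) < norm f" using f(2) by (auto simp: sees_def)
  have "T x \<noteq> 0"
  proof
    assume "T x = 0"
    then have "(f - s *\<^sub>R (g o\<^sub>L T)) x = norm f" using x by (simp add: blinfun.bilinear_simps)
    then show False using s norm_blinfun[of "f - s *\<^sub>R (g o\<^sub>L T)" x] x(1) by simp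
  qed
  then obtain y where y: "y \<in> B" "sees y (T x)" using assms(3) by (auto simp: sees_all_def)
  have "sees (rank_one f y) T" using rank_one_sees_exposing[OF x(1,3,4) y(2)] .
  then show "\<exists>z\<in>(\<lambda>(f, y). rank_one f y) ` (A \<times> B). sees z T" using f y by force
qed

text \<open>A point \<open>y\<close> that sees \<open>T v\<close> forces \<open>g (T v) \<noteq> 0\<close> for every functional \<open>g\<close> supporting the norm
  at \<open>y\<close>, by the dual argument.\<close>

lemma sees_all_rank_one_frechet:
  fixes A :: "('a::real_normed_vector \<Rightarrow>\<^sub>L real) set" and B :: "'b::real_normed_vector set"
  assumes "B \<subseteq> {y. norm_frechet_differentiable_at y}" "sees_all A UNIV" "sees_all B UNIV"
  shows "sees_all ((\<lambda>(f, y). rank_one f y) ` (A \<times> B)) UNIV"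
  unfolding sees_all_def
proof
  fix T :: "'a \<Rightarrow>\<^sub>L 'b" assume "T \<in> UNIV - {0}"
  then obtain v where v: "T v \<noteq> 0" using blinfun_eqI[of T 0] by auto
  then obtain y where y: "y \<in> B" "sees y (T v)" using assms(3) by (auto simp: sees_all_def)
  obtain g :: "'b \<Rightarrow>\<^sub>L real" where g: "norm g \<le> 1" "g y = norm y" using ex_support_functional by blast
  obtain s where s: "norm (y - s *\<^sub>R T v) < norm y" using y(2) by (auto simp: sees_def)
  have "g (y - s *\<^sub>R T v) \<le> norm (y - s *\<^sub>R T v)"
    using norm_blinfun[of g "y - s *\<^sub>R T v"] mult_right_mono[OF g(1) norm_ge_zero[of "y - s *\<^sub>R T v"]] by simp
  then have "(g o\<^sub>L T) v \<noteq> 0" using s g(2) by (auto simp: blinfun.bilinear_simps)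
  then have "g o\<^sub>L T \<noteq> 0" by (metis blinfun.zero_left)
  then obtain f where f: "f \<in> A" "sees f (g o\<^sub>L T)" using assms(2) by (auto simp: sees_all_def)
  have "norm_frechet_differentiable_at y" using y assms(1) by blast
  then have "sees (rank_one f y) T" using rank_one_sees_frechet g f(2) by blast
  then show "\<exists>z\<in>(\<lambda>(f, y). rank_one f y) ` (A \<times> B). sees z T" using f y by force
qed

theorem theorem1p3:
  fixes W :: "('a::banach \<Rightarrow>\<^sub>L 'b::banach) set"
  assumes "(UNIV :: 'a set) \<noteq> {0}" and "(UNIV :: 'b set) \<noteq> {0}"
    and "closure (SE :: ('a \<Rightarrow>\<^sub>L real) set) = UNIV
         \<or> closure {y :: 'b. norm_frechet_differentiable_at y} = UNIV"
    and "subspace W" and "finite_rank_ops \<subseteq> W"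
  shows "BCP W \<longleftrightarrow> BCP (UNIV :: ('a \<Rightarrow>\<^sub>L real) set) \<and> BCP (UNIV :: 'b set)"
proof
  assume "BCP W"
  then show "BCP (UNIV :: ('a \<Rightarrow>\<^sub>L real) set) \<and> BCP (UNIV :: 'b set)"
    using BCP_dual_of_BCP_operators BCP_range_of_BCP_operators assms by blast
next
  assume BCP: "BCP (UNIV :: ('a \<Rightarrow>\<^sub>L real) set) \<and> BCP (UNIV :: 'b set)"
  obtain x0 :: 'a where x0: "x0 \<noteq> 0" using assms(1) by blast
  obtain f0 :: "'a \<Rightarrow>\<^sub>L real" where "f0 x0 = norm x0" using ex_support_functional by blast
  then have f0: "f0 \<noteq> 0" using x0 by auto
  then have nzX: "(UNIV :: ('a \<Rightarrow>\<^sub>L real) set) \<noteq> {0}" by auto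
  obtain y0 :: 'b where y0: "y0 \<noteq> 0" using assms(2) by blast
  have "norm (rank_one f0 y0) \<noteq> 0" using f0 y0 by (simp add: norm_rank_one)
  moreover have inW: "rank_one f y \<in> W" for f y using assms(5) rank_one_finite_rank by blast
  ultimately have nzW: "W \<noteq> {0}" by (metis norm_zero singletonD)
  obtain A :: "('a \<Rightarrow>\<^sub>L real) set" where A: "countable A" "sees_all A UNIV"
    using BCP BCP_iff_sees_all[OF subspace_UNIV nzX] by blast
  obtain B :: "'b set" where B: "countable B" "sees_all B UNIV"
    using BCP BCP_iff_sees_all[OF subspace_UNIV assms(2)] by blast
  have "\<exists>A' B'. countable A' \<and> countable B' \<and>
    sees_all ((\<lambda>(f :: 'a \<Rightarrow>\<^sub>L real, y :: 'b). rank_one f y) ` (A' \<times> B')) UNIV"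
    using assms(3)
  proof
    assume "closure (SE :: ('a \<Rightarrow>\<^sub>L real) set) = UNIV"
    then obtain A' :: "('a \<Rightarrow>\<^sub>L real) set" where "countable A'" "A' \<subseteq> SE" "sees_all A' UNIV"
      using sees_all_dense[OF A] by blast
    then show ?thesis using B sees_all_rank_one_SE by blast
  next
    assume "closure {y :: 'b. norm_frechet_differentiable_at y} = UNIV"
    then obtain B' :: "'b set"
      where "countable B'" "B' \<subseteq> {y. norm_frechet_differentiable_at y}" "sees_all B' UNIV"
      using sees_all_dense[OF B] by blast
    then show ?thesis using A sees_all_rank_one_frechet by blast
  qed
  then obtain A' B' where *: "countable A'" "countable B'"
    "sees_all ((\<lambda>(f :: 'a \<Rightarrow>\<^sub>L real, y :: 'b). rank_one f y) ` (A' \<times> B')) UNIV" by blast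
  let ?C = "(\<lambda>(f, y). rank_one f y) ` (A' \<times> B')"
  have "countable ?C" "?C \<subseteq> W" "sees_all ?C W" using * inW by (auto simp: sees_all_def)
  then show "BCP W" using BCP_iff_sees_all[OF assms(4) nzW] by blast
qed

end
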